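(* There are no graphs with valency-array $(1,30,5,15;45,34,18,13)$ and spectrum $\{[30]^1,[3]^{20},[-3]^{30}\}$.
   Context: All graphs are finite and simple. The valency-array $(n_1,\dots,n_r;k_1,\dots,k_r)$ of a graph with distinct valencies (degrees) $k_1>\dots>k_r$ records that exactly $n_i$ vertices have valency $k_i$ for each $i$ (and there are no other vertices). The spectrum is that of the adjacency matrix, where $[\theta]^m$ means that $\theta$ is an eigenvalue with multiplicity $m$. *)

theory Defs
  imports
    "Graph_Theory.Pair_Digraph"
    "Jordan_Normal_Form.Spectral_Radius"
begin

text \<open>
  A finite simple graph is a \<^locale>\<open>pair_graph\<close>: a finite vertex set together with a finite,
  irreflexive and symmetric arc relation on it, so that an edge is a pair of opposite arcs
  and the valency of a vertex is its out-degree.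
\<close>

definition valency :: "'a pair_pre_digraph \<Rightarrow> 'a \<Rightarrow> nat" where
  "valency G v = out_degree (with_proj G) v"

text \<open>
  \<open>ns\<close> and \<open>ks\<close> are the two halves of \<open>(n\<^sub>1, \<dots>, n\<^sub>r; k\<^sub>1, \<dots>, k\<^sub>r)\<close>. The condition on \<open>set ks\<close>
  says that every listed valency occurs and that no other one does.
\<close>

definition has_valency_array :: "'a pair_pre_digraph \<Rightarrow> nat list \<Rightarrow> nat list \<Rightarrow> bool" where
  "has_valency_array G ns ks \<longleftrightarrow>
     length ns = length ks \<and>
     sorted_wrt (>) ks \<and>
     set ks = valency G ` pverts G \<and>
     (\<forall>i < length ks. card {v \<in> pverts G. valency G v = ks ! i} = ns ! i)"

text \<open>The list \<open>vs\<close> enumerates the vertices and so fixes the order of rows and columns.\<close>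

definition adjacency_matrix :: "'a pair_pre_digraph \<Rightarrow> 'a list \<Rightarrow> real mat" where
  "adjacency_matrix G vs =
     mat (length vs) (length vs) (\<lambda>(i, j). if (vs ! i, vs ! j) \<in> parcs G then 1 else 0)"

text \<open>
  A list entry \<open>(\<theta>, m)\<close> stands for \<open>[\<theta>]\<^sup>m\<close>. Multiplicities are those of the roots of the
  characteristic polynomial; real eigenvalues suffice because the matrix of a graph is symmetric.
  Different enumerations give similar matrices, so the choice of \<open>vs\<close> is immaterial.
\<close>

definition has_spectrum :: "'a pair_pre_digraph \<Rightarrow> (real \<times> nat) list \<Rightarrow> bool" where
  "has_spectrum G S \<longleftrightarrow>
     (\<exists>vs. distinct vs \<and> set vs = pverts G \<and>
        spectrum (adjacency_matrix G vs) = fst ` set S \<and>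
        (\<forall>(\<theta>, m) \<in> set S. Polynomial.order \<theta> (char_poly (adjacency_matrix G vs)) = m))"

end

theory Submission
  imports Defs
begin

text \<open>
  If \<open>A\<close> is the adjacency matrix, \<open>A\<^sup>2 - 9\<close> vanishes on the eigenspaces of \<open>3\<close> and \<open>- 3\<close> and has
  trace \<open>891 = 30\<^sup>2 - 9\<close>, so it is \<open>\<alpha>\<alpha>\<^sup>T\<close> with \<open>\<alpha> u\<^sup>2 = valency u - 9\<close>, that is \<open>\<alpha> \<in> {6, 5, 3, 2}\<close>.
  Hence the numbers of common neighbours are known; they show that the vertex \<open>x\<close> of valency 45 is
  adjacent exactly to the sets \<open>P\<close> and \<open>Q\<close> of vertices of valency 34 and 13, and that each vertex
  has the same number of neighbours in \<open>P\<close>, \<open>Q\<close> and the set \<open>T\<close> of vertices of valency 18 as the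
  other vertices of its own class. The complement \<open>b\<close> of the graph induced on \<open>P\<close> is 4-regular
  and triangle-free, and \<open>Q\<close> induces disjoint triangles. For \<open>b\<close>-adjacent \<open>u\<close> and \<open>v\<close> the
  positive semidefinite form \<open>A + 3\<close> on \<open>\<alpha>\<^sup>\<bottom>\<close> gives a lower bound on \<open>W u v\<close>, an integer combination of intersection numbers.
  Summation over the four \<open>b\<close>-neighbours of \<open>u\<close> shows that all these bounds are tight, which forces
  \<open>3\<close> to divide the number of common neighbours of \<open>u\<close> and \<open>v\<close> in \<open>T\<close>; but that number is 1 or 2.
\<close>

section \<open>Symmetric matrices with prescribed spectrum\<close>

lemma sum_mult_swap:
  fixes f :: "'a \<Rightarrow> 'c::comm_semiring_0" and g :: "'b \<Rightarrow> 'c"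
  shows "(\<Sum>v\<in>X. f v * (\<Sum>z\<in>Y. g z * h v z)) = (\<Sum>z\<in>Y. g z * (\<Sum>v\<in>X. f v * h v z))"
proof -
  have "(\<Sum>v\<in>X. f v * (\<Sum>z\<in>Y. g z * h v z)) = (\<Sum>v\<in>X. \<Sum>z\<in>Y. g z * (f v * h v z))"
    by (simp add: sum_distrib_left mult.left_commute)
  also have "\<dots> = (\<Sum>z\<in>Y. \<Sum>v\<in>X. g z * (f v * h v z))" by (rule sum.swap)
  finally show ?thesis by (simp add: sum_distrib_left)
qed

section \<open>Shifted operators on functions and symmetric matrices\<close>

text \<open>This is \<open>(A - e) f\<close>, with vectors as plain functions; \<open>shifts\<close>
  is then a product of such operators over a list.\<close>

definition shift :: "('i \<Rightarrow> 'i \<Rightarrow> real) \<Rightarrow> 'i set \<Rightarrow> real \<Rightarrow> ('i \<Rightarrow> real) \<Rightarrow> 'i \<Rightarrow> real" where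
  "shift a V e f u = (\<Sum>v\<in>V. a u v * f v) - e * f u"

abbreviation shifts where "shifts a V \<equiv> foldr (shift a V)"

lemma shift_commute: "shift a V e (shift a V e' f) = shift a V e' (shift a V e f)"
  by (rule ext) (simp add: shift_def right_diff_distrib sum_subtractf mult.left_commute flip: sum_distrib_left)

lemma shifts_commute: "shifts a V es (shift a V e f) = shift a V e (shifts a V es f)"
  by (induction es) (simp_all add: shift_commute)

lemma shift_cong:
  "(\<And>v. v \<in> V \<Longrightarrow> f v = g v) \<Longrightarrow> u \<in> V \<Longrightarrow> shift a V e f u = shift a V e g u"
  by (simp add: shift_def)

lemma shifts_cong:
  "(\<And>v. v \<in> V \<Longrightarrow> f v = g v) \<Longrightarrow> u \<in> V \<Longrightarrow> shifts a V es f u = shifts a V es g u"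
  by (induction es arbitrary: u) (auto intro: shift_cong)

lemma shift_sum:
  "shift a V e (\<lambda>u. \<Sum>j\<in>J. c j * g j u) = (\<lambda>u. \<Sum>j\<in>J. c j * shift a V e (g j) u)"
proof
  fix u
  have "(\<Sum>v\<in>V. a u v * (\<Sum>j\<in>J. c j * g j v)) = (\<Sum>v\<in>V. \<Sum>j\<in>J. c j * (a u v * g j v))"
    by (simp add: sum_distrib_left mult.left_commute)
  also have "\<dots> = (\<Sum>j\<in>J. \<Sum>v\<in>V. c j * (a u v * g j v))" by (rule sum.swap)
  finally show "shift a V e (\<lambda>u. \<Sum>j\<in>J. c j * g j u) u = (\<Sum>j\<in>J. c j * shift a V e (g j) u)"
    by (simp add: shift_def right_diff_distrib sum_subtractf sum_distrib_left mult.left_commute)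
qed

lemma shifts_sum:
  "shifts a V es (\<lambda>u. \<Sum>j\<in>J. c j * g j u) = (\<lambda>u. \<Sum>j\<in>J. c j * shifts a V es (g j) u)"
  by (induction es) (simp_all add: shift_sum)

lemma shifts_remove1:
  "e \<in> set es \<Longrightarrow> shifts a V es f = shift a V e (shifts a V (remove1 e es) f)"
  by (induction es) (auto simp: shift_commute)

text \<open>With \<open>g = (A - e) f\<close>, symmetry moves \<open>A - e\<close> across the inner
  product: \<open>g\<close> paired with itself equals \<open>f\<close> paired with
  \<open>(A - e) g\<close>, which is zero. A vanishing sum of squares forces
  \<open>g = 0\<close>.\<close>

lemma symmetric_shift_kernel:
  assumes "finite V" and sym: "\<And>u v. u \<in> V \<Longrightarrow> v \<in> V \<Longrightarrow> a u v = a v u"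
    and zero: "\<And>u. u \<in> V \<Longrightarrow> shift a V e (shift a V e f) u = 0" and "u \<in> V"
  shows "shift a V e f u = 0"
proof -
  define g where "g = shift a V e f"
  have "(\<Sum>u\<in>V. g u * g u) = (\<Sum>u\<in>V. \<Sum>v\<in>V. g u * (a u v * f v)) - (\<Sum>u\<in>V. e * (g u * f u))"
    by (subst (2) g_def) (simp add: shift_def right_diff_distrib sum_subtractf sum_distrib_left mult.left_commute)
  also have "(\<Sum>u\<in>V. \<Sum>v\<in>V. g u * (a u v * f v)) = (\<Sum>v\<in>V. \<Sum>u\<in>V. g u * (a u v * f v))"
    by (rule sum.swap)
  also have "\<dots> = (\<Sum>v\<in>V. f v * (\<Sum>u\<in>V. a v u * g u))"
    by (auto simp: sum_distrib_left sym intro!: sum.cong)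
  also have "\<dots> - (\<Sum>u\<in>V. e * (g u * f u)) = (\<Sum>v\<in>V. f v * shift a V e g v)"
    by (simp add: shift_def right_diff_distrib sum_subtractf mult.left_commute mult.commute)
  also have "\<dots> = 0" using zero by (simp add: g_def)
  finally have "g u * g u = 0"
    using assms by (subst (asm) sum_nonneg_eq_0_iff) auto
  then show ?thesis by (simp add: g_def)
qed

text \<open>Triangularise; each new basis vector is killed modulo the previous ones, and for a symmetric
  matrix the kernel of a squared shift is the kernel of the shift, so multiplicities do not matter.\<close>

lemma symmetric_annihilated:
  fixes A :: "real mat"
  assumes A: "A \<in> carrier_mat n n"
    and sym: "\<And>i j. i < n \<Longrightarrow> j < n \<Longrightarrow> A $$ (i, j) = A $$ (j, i)"
    and char: "char_poly A = (\<Prod>e\<leftarrow>es. [:- e, 1:])" and "set es \<subseteq> set ms" and "i < n"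
  shows "shifts (\<lambda>i j. A $$ (i, j)) {..<n} ms f i = 0"
proof -
  let ?V = "{..<n}" and ?a = "\<lambda>i j. A $$ (i, j)"
  obtain B P Q where "schur_decomposition A es = (B, P, Q)" using prod_cases3 by blast
  from schur_decomposition[OF A char this] have wit: "similar_mat_wit A B P Q"
    and tri: "upper_triangular B" and diag: "diag_mat B = es" by auto
  note w = similar_mat_witD2[OF A wit]
  have "A * P = P * B"
    using w by (metis assoc_mult_mat mult_carrier_mat right_mult_one_mat)
  then have eq: "(A * P) $$ (i, k) = (P * B) $$ (i, k)" for i k by simp
  have AP: "(\<Sum>j<n. A $$ (i, j) * P $$ (j, k)) = (\<Sum>j<n. B $$ (j, k) * P $$ (i, j))"
    if "i < n" "k < n" for i k
    using eq[of i k] that w(4-6) by (simp add: scalar_prod_def atLeast0LessThan mult.commute)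
  have *: "\<forall>i<n. shifts ?a ?V ms (\<lambda>i. P $$ (i, k)) i = 0" if "k < n" for k
    using that
  proof (induction k rule: less_induct)
    case (less k)
    let ?p = "\<lambda>k i. P $$ (i, k)" and ?e = "B $$ (k, k)"
    have e: "?e \<in> set ms"
      using diag assms(4) less.prems w by (auto simp: diag_mat_def)
    \<comment> \<open>Column \<open>k\<close> of \<open>A P = P B\<close> with \<open>B\<close>
      upper triangular: applying \<open>A - B k k\<close> to the column leaves a combination of
      earlier columns, which the induction hypothesis kills.\<close>
    have step: "shift ?a ?V ?e (?p k) i = (\<Sum>j<k. B $$ (j, k) * ?p j i)" if "i < n" for i
    proof -
      have "(\<Sum>j<n. B $$ (j, k) * P $$ (i, j)) = (\<Sum>j<Suc k. B $$ (j, k) * P $$ (i, j))"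
        using tri w less.prems by (intro sum.mono_neutral_right) (auto simp: upper_triangular_def)
      then show ?thesis using AP[OF that less.prems] by (simp add: shift_def)
    qed
    have "shifts ?a ?V ms (shift ?a ?V ?e (?p k)) i = 0" if "i < n" for i
    proof -
      have "shifts ?a ?V ms (shift ?a ?V ?e (?p k)) i = shifts ?a ?V ms (\<lambda>i. \<Sum>j<k. B $$ (j, k) * ?p j i) i"
        using that step by (intro shifts_cong) auto
      also have "\<dots> = 0" unfolding shifts_sum using less that by simp
      finally show ?thesis .
    qed
    then have "shift ?a ?V ?e (shift ?a ?V ?e (shifts ?a ?V (remove1 ?e ms) (?p k))) i = 0" if "i < n" for i
      using that by (simp only: shifts_commute shifts_remove1[OF e])
    then show ?case
      using symmetric_shift_kernel[of ?V ?a ?e] sym by (simp add: shifts_remove1[OF e])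
  qed
  \<comment> \<open>Since \<open>P Q = 1\<close>, every \<open>f\<close> is the combination of the
    columns of \<open>P\<close> with coefficients \<open>Q f\<close>.\<close>
  have expand: "f i = (\<Sum>k<n. (\<Sum>j<n. Q $$ (k, j) * f j) * P $$ (i, k))" if "i < n" for i
  proof -
    have PQ: "(\<Sum>k<n. P $$ (i, k) * Q $$ (k, j)) = (if i = j then 1 else 0)" if "j < n" for j
    proof -
      have "(P * Q) $$ (i, j) = (if i = j then 1 else 0)" using w \<open>i < n\<close> that by simp
      then show ?thesis using w(6,7) \<open>i < n\<close> that by (simp add: scalar_prod_def atLeast0LessThan)
    qed
    have "(\<Sum>k<n. (\<Sum>j<n. Q $$ (k, j) * f j) * P $$ (i, k)) = (\<Sum>k<n. \<Sum>j<n. f j * (P $$ (i, k) * Q $$ (k, j)))"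
      by (simp add: sum_distrib_right sum_distrib_left ac_simps)
    also have "\<dots> = (\<Sum>j<n. \<Sum>k<n. f j * (P $$ (i, k) * Q $$ (k, j)))" by (rule sum.swap)
    also have "\<dots> = (\<Sum>j<n. f j * (if i = j then 1 else 0))"
      by (intro sum.cong refl) (simp add: PQ flip: sum_distrib_left)
    also have "\<dots> = f i" using that by (simp add: if_distrib cong: if_cong)
    finally show ?thesis by simp
  qed
  have "shifts ?a ?V ms f i = shifts ?a ?V ms (\<lambda>i. \<Sum>k<n. (\<Sum>j<n. Q $$ (k, j) * f j) * P $$ (i, k)) i"
    using \<open>i < n\<close> by (intro shifts_cong expand) simp_all
  also have "\<dots> = 0" unfolding shifts_sum using * \<open>i < n\<close> by simp
  finally show ?thesis .
qed

section \<open>Splitting a polynomial by the orders of its roots\<close>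

text \<open>Induction on \<open>S\<close>. The last conjunct carries it: factors for other roots do
  not change the order at a new root \<open>r\<close>, so its full power still divides the cofactor
  \<open>q\<close>.\<close>

lemma split_off_roots:
  fixes p :: "'a::field poly"
  assumes "finite S" and "p \<noteq> 0"
  shows "\<exists>es q. p = (\<Prod>e\<leftarrow>es. [:- e, 1:]) * q \<and> set es \<subseteq> S \<and> length es = (\<Sum>r\<in>S. Polynomial.order r p) \<and>
    (\<forall>r. r \<notin> S \<longrightarrow> Polynomial.order r q = Polynomial.order r p)"
  using assms(1)
proof (induction S)
  case empty
  then show ?case by (intro exI[of _ "[]"] exI[of _ p]) simp
next
  case (insert r S)
  then obtain es q where q: "p = (\<Prod>e\<leftarrow>es. [:- e, 1:]) * q" "set es \<subseteq> S"
    "length es = (\<Sum>r\<in>S. Polynomial.order r p)"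
    and ord: "\<And>r. r \<notin> S \<Longrightarrow> Polynomial.order r q = Polynomial.order r p" by blast
  let ?m = "Polynomial.order r p"
  have "[:- r, 1:] ^ ?m dvd q" using order_1[of r q] ord[OF insert.hyps(2)] by simp
  then obtain q' where q': "q = [:- r, 1:] ^ ?m * q'" by (elim dvdE)
  have "q \<noteq> 0" using q assms by auto
  have "Polynomial.order r' q' = Polynomial.order r' p" if "r' \<notin> insert r S" for r'
  proof -
    have "Polynomial.order r' ([:- r, 1:] ^ ?m) = 0" using that by (intro order_0I) auto
    moreover have "Polynomial.order r' q = Polynomial.order r' ([:- r, 1:] ^ ?m) + Polynomial.order r' q'"
      using order_mult[of "[:- r, 1:] ^ ?m" q' r'] \<open>q \<noteq> 0\<close> q' by simp
    ultimately show ?thesis using ord that by auto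
  qed
  moreover have "p = (\<Prod>e\<leftarrow>replicate ?m r @ es. [:- e, 1:]) * q'"
    by (subst q(1), subst q') (simp add: prod_list_replicate mult_ac)
  ultimately show ?case using q insert.hyps
    by (intro exI[of _ "replicate ?m r @ es"] exI[of _ q']) auto
qed

text \<open>The linear factors use up the whole degree, so the cofactor is constant, and it is 1
  because both sides are monic.\<close>

lemma splits_if_orders_sum_to_degree:
  fixes p :: "'a::field poly"
  assumes "finite S" and monic: "lead_coeff p = 1" and deg: "(\<Sum>r\<in>S. Polynomial.order r p) = degree p"
  obtains es where "p = (\<Prod>e\<leftarrow>es. [:- e, 1:])" "set es \<subseteq> S"
proof -
  have p0: "p \<noteq> 0" using monic by auto
  from split_off_roots[OF assms(1) p0] deg obtain es q where
    q: "p = (\<Prod>e\<leftarrow>es. [:- e, 1:]) * q" "set es \<subseteq> S" "length es = degree p" by auto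
  let ?p = "\<Prod>e\<leftarrow>es. [:- e, 1:]"
  have "?p \<noteq> 0" "q \<noteq> 0" using q p0 by auto
  then have "degree p = degree ?p + degree q" by (subst q(1)) (rule degree_mult_eq)
  moreover have "degree ?p = length es" by (rule degree_linear_factors)
  ultimately have "degree q = 0" using q by simp
  then obtain d where d: "q = [:d:]" using degree_0_id by metis
  have "lead_coeff ?p = 1" by (rule monic_prod_list) auto
  moreover have "lead_coeff p = lead_coeff ?p * lead_coeff q"
    using lead_coeff_mult[of ?p q] by (simp flip: q(1))
  ultimately have "d = 1" using monic d by simp
  then show ?thesis using q d by (intro that) auto
qed

section \<open>Rank one from idempotence and trace\<close>

text \<open>For nonzero \<open>c\<close>, \<open>y / c\<close> is a symmetric idempotent of trace 1,
  hence a projection of rank one, and its 2 by 2 minors vanish. The proof avoids division and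
  rank.\<close>

lemma symmetric_idempotent_minors:
  fixes y :: "'i \<Rightarrow> 'i \<Rightarrow> 'r::linordered_idom"
  assumes "finite V" and sym: "\<And>u v. u \<in> V \<Longrightarrow> v \<in> V \<Longrightarrow> y u v = y v u"
    and idem: "\<And>u v. u \<in> V \<Longrightarrow> v \<in> V \<Longrightarrow> (\<Sum>w\<in>V. y u w * y w v) = c * y u v"
    and trace: "(\<Sum>u\<in>V. y u u) = c" and u: "u \<in> V" and v: "v \<in> V"
  shows "y u v * y u v = y u u * y v v"
proof -
  \<comment> \<open>\<open>z u u\<close> is the wanted minor. The square of \<open>z\<close> has
    diagonal \<open>c * y v v\<close> times that of \<open>z\<close>, whose trace is 0; so the
    squares of all entries of \<open>z\<close> sum to 0.\<close>
  define z where "z p q = y v v * y p q - y p v * y v q" for p q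
  have zz: "(\<Sum>w\<in>V. z p w * z w p) = c * y v v * z p p" if "p \<in> V" for p
  proof -
    have "(\<Sum>w\<in>V. z p w * z w p) = (\<Sum>w\<in>V. y v v * y v v * (y p w * y w p) - y v v * y v p * (y p w * y w v)
        - y v v * y p v * (y v w * y w p) + y p v * y v p * (y v w * y w v))"
      by (intro sum.cong refl) (simp add: z_def algebra_simps)
    also have "\<dots> = y v v * y v v * (c * y p p) - y v v * y v p * (c * y p v)
        - y v v * y p v * (c * y v p) + y p v * y v p * (c * y v v)"
      using idem that v by (simp add: sum.distrib sum_subtractf flip: sum_distrib_left)
    finally show ?thesis by (simp add: z_def algebra_simps)
  qed
  have "(\<Sum>p\<in>V. z p p) = y v v * (\<Sum>p\<in>V. y p p) - (\<Sum>p\<in>V. y v p * y p v)"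
    by (simp add: z_def sum_subtractf sum_distrib_left mult.commute)
  also have "\<dots> = 0" using idem[OF v v] trace by (simp add: mult.commute)
  finally have "(\<Sum>p\<in>V. \<Sum>w\<in>V. z p w * z w p) = 0"
    by (simp add: zz flip: sum_distrib_left)
  moreover have "z p w * z w p = z p w * z p w" if "p \<in> V" "w \<in> V" for p w
    using sym that v by (simp add: z_def mult.commute)
  ultimately have "(\<Sum>p\<in>V. \<Sum>w\<in>V. z p w * z p w) = 0" by simp
  then have "(\<Sum>w\<in>V. z u w * z u w) = 0"
    using assms(1) u by (subst (asm) sum_nonneg_eq_0_iff) (auto intro: sum_nonneg)
  then have "z u u * z u u = 0"
    using assms(1) u by (subst (asm) sum_nonneg_eq_0_iff) auto
  then show ?thesis using sym u v by (simp add: z_def mult.commute)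
qed

text \<open>Here \<open>y = A^2 - m\<close>, and \<open>A y = \<theta> y\<close> gives
  \<open>y^2 = (\<theta>^2 - m) y\<close>. The trace has the same factor, so the minors vanish and
  \<open>y u v\<close> is \<open>\<alpha> u * \<alpha> v\<close> up to sign; off the diagonal
  \<open>y\<close> counts walks, which fixes the sign. Reading \<open>A y = \<theta> y\<close> in
  one column shows that \<open>\<alpha>\<close> is an eigenvector.\<close>

lemma rank_one_square:
  fixes a :: "'i \<Rightarrow> 'i \<Rightarrow> int" and V :: "'i set" and m :: int
  defines "y u v \<equiv> (\<Sum>w\<in>V. a u w * a w v) - (if u = v then m else 0)"
  assumes fin: "finite V" and sym: "\<And>u v. a u v = a v u" and nonneg: "\<And>u v. 0 \<le> a u v"
    and eigen: "\<And>u v. u \<in> V \<Longrightarrow> v \<in> V \<Longrightarrow> (\<Sum>w\<in>V. a u w * y w v) = \<theta> * y u v"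
    and diag: "\<And>u. u \<in> V \<Longrightarrow> y u u = \<alpha> u * \<alpha> u" and pos: "\<And>u. u \<in> V \<Longrightarrow> 0 < \<alpha> u"
    and trace: "(\<Sum>u\<in>V. \<alpha> u * \<alpha> u) = \<theta> * \<theta> - m"
    and u: "u \<in> V"
  shows "v \<in> V \<Longrightarrow> (\<Sum>w\<in>V. a u w * a w v) = (if u = v then m else 0) + \<alpha> u * \<alpha> v"
    and "(\<Sum>w\<in>V. a u w * \<alpha> w) = \<theta> * \<alpha> u"
proof -
  have y_sym: "y p q = y q p" for p q
    by (simp add: y_def sym[of p] sym[of q] mult.commute)
  have y_sq: "(\<Sum>w\<in>V. y p w * y w q) = (\<theta> * \<theta> - m) * y p q" if "p \<in> V" "q \<in> V" for p q
  proof -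
    have "(\<Sum>w\<in>V. y p w * y w q) = (\<Sum>w\<in>V. y w q * (\<Sum>r\<in>V. a p r * a r w) - (if w = p then m * y w q else 0))"
      by (intro sum.cong refl) (auto simp: y_def[of p] algebra_simps)
    also have "\<dots> = (\<Sum>w\<in>V. y w q * (\<Sum>r\<in>V. a p r * a r w)) - m * y p q"
      using fin that by (simp add: sum_subtractf)
    also have "(\<Sum>w\<in>V. y w q * (\<Sum>r\<in>V. a p r * a r w)) = (\<Sum>r\<in>V. a p r * (\<Sum>w\<in>V. y w q * a r w))"
      by (rule sum_mult_swap)
    also have "\<dots> = (\<Sum>r\<in>V. a p r * (\<theta> * y r q))"
      using that by (intro sum.cong refl) (simp add: eigen[symmetric] mult.commute)
    also have "\<dots> = \<theta> * (\<theta> * y p q)"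
      using that by (simp add: mult.left_commute eigen flip: sum_distrib_left)
    finally show ?thesis by (simp add: left_diff_distrib)
  qed
  have y: "y p q = \<alpha> p * \<alpha> q" if "p \<in> V" "q \<in> V" for p q
  proof (cases "p = q")
    case False
    have "y p q * y p q = y p p * y q q"
      using symmetric_idempotent_minors[of V y "\<theta> * \<theta> - m" p q] fin y_sym y_sq that diag trace by simp
    then have "(y p q)\<^sup>2 = (\<alpha> p * \<alpha> q)\<^sup>2"
      using that by (simp add: diag power2_eq_square mult_ac)
    moreover have "0 \<le> y p q" using False by (simp add: y_def sum_nonneg nonneg)
    ultimately show ?thesis using pos[OF that(1)] pos[OF that(2)] by (simp add: power2_eq_iff_nonneg)
  qed (use diag that in simp)
  then show "v \<in> V \<Longrightarrow> (\<Sum>w\<in>V. a u w * a w v) = (if u = v then m else 0) + \<alpha> u * \<alpha> v"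
    using y[OF u, of v] by (simp add: y_def split: if_splits)
  have "\<alpha> u * (\<Sum>w\<in>V. a u w * \<alpha> w) = (\<Sum>w\<in>V. a u w * y w u)"
    using u by (simp add: y sum_distrib_left mult_ac)
  also have "\<dots> = \<alpha> u * (\<theta> * \<alpha> u)" by (simp only: eigen[OF u u] y[OF u u] mult.left_commute)
  finally show "(\<Sum>w\<in>V. a u w * \<alpha> w) = \<theta> * \<alpha> u" using pos[OF u] by simp
qed

section \<open>Local structure\<close>

text \<open>The graph enters only through its 0-1 adjacency function, integer valued so that
  divisibility can be used at the end.\<close>

locale three_eigenvalue_graph =
  fixes x :: 'a and P T Q :: "'a set" and a :: "'a \<Rightarrow> 'a \<Rightarrow> int" and \<alpha> :: "'a \<Rightarrow> int"
  assumes fin: "finite P" "finite T" "finite Q"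
    and disj: "x \<notin> P" "x \<notin> T" "x \<notin> Q" "P \<inter> T = {}" "P \<inter> Q = {}" "T \<inter> Q = {}"
    and cards: "card P = 30" "card T = 5" "card Q = 15"
    and \<alpha>_x: "\<alpha> x = 6" and \<alpha>_P: "u \<in> P \<Longrightarrow> \<alpha> u = 5" and \<alpha>_T: "u \<in> T \<Longrightarrow> \<alpha> u = 3"
    and \<alpha>_Q: "u \<in> Q \<Longrightarrow> \<alpha> u = 2"
    and a_cases: "a u v = 0 \<or> a u v = 1" and a_sym: "a u v = a v u" and a_irrefl [simp]: "a u u = 0"
    and square: "u \<in> insert x (P \<union> T \<union> Q) \<Longrightarrow> v \<in> insert x (P \<union> T \<union> Q) \<Longrightarrow>
      (\<Sum>w\<in>insert x (P \<union> T \<union> Q). a u w * a w v) = (if u = v then 9 else 0) + \<alpha> u * \<alpha> v"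
    and eigen: "u \<in> insert x (P \<union> T \<union> Q) \<Longrightarrow>
      (\<Sum>w\<in>insert x (P \<union> T \<union> Q). a u w * \<alpha> w) = 30 * \<alpha> u"
begin

abbreviation V where "V \<equiv> insert x (P \<union> T \<union> Q)"

lemma sum_V: "sum f V = f x + sum f P + sum f T + sum f Q" for f :: "'a \<Rightarrow> int"
proof -
  have "sum f (P \<union> T \<union> Q) = sum f P + sum f T + sum f Q"
    using fin disj by (subst sum.union_disjoint; auto simp: sum.union_disjoint)
  then show ?thesis using fin disj by simp
qed

lemma a_nonneg: "0 \<le> a u v" and a_le_1: "a u v \<le> 1" and a_idem [simp]: "a u v * a u v = a u v"
  using a_cases[of u v] by auto

lemma degree: "u \<in> V \<Longrightarrow> (\<Sum>w\<in>V. a u w) = 9 + \<alpha> u * \<alpha> u"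
  using square[of u u] by (simp add: a_sym[of _ u] cong: sum.cong)

section \<open>Adjacencies between the classes\<close>

text \<open>A vertex \<open>z\<close> of \<open>T\<close> has valency 18 and
  \<open>3 * 6 = 18\<close> common neighbours with \<open>x\<close>. So each neighbour of
  \<open>z\<close> is a neighbour of \<open>x\<close>, and \<open>x\<close> is not its own
  neighbour.\<close>

lemma T_x: assumes "z \<in> T" shows "a z x = 0" "a x z = 0"
proof -
  have "z \<noteq> x" using assms disj by auto
  then have "(\<Sum>w\<in>V. a z w * (1 - a w x)) = 0"
    using degree[of z] square[of z x] assms
    by (simp only: right_diff_distrib sum_subtractf) (simp add: \<alpha>_T \<alpha>_x)
  then have "a z x * (1 - a x x) = 0"
    using fin by (subst (asm) sum_nonneg_eq_0_iff) (auto simp: a_nonneg a_le_1)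
  then show "a z x = 0" "a x z = 0" by (simp_all add: a_sym)
qed

text \<open>All 45 neighbours of \<open>x\<close> lie in \<open>P\<close> and \<open>Q\<close>,
  which have \<open>30 + 15\<close> vertices together.\<close>

lemma x_adjacent: assumes "u \<in> P \<union> Q" shows "a x u = 1" "a u x = 1"
proof -
  have "(\<Sum>w\<in>T. a x w) = 0" using T_x by simp
  then have "(\<Sum>w\<in>P. a x w) + (\<Sum>w\<in>Q. a x w) = 45" using degree[of x] by (simp only: sum_V) (simp add: \<alpha>_x)
  then have "(\<Sum>w\<in>P. 1 - a x w) + (\<Sum>w\<in>Q. 1 - a x w) = 0"
    using cards by (simp add: sum_subtractf)
  then have "(\<Sum>w\<in>P\<union>Q. 1 - a x w) = 0" using fin disj by (simp add: sum.union_disjoint)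
  then show "a x u = 1"
    using fin assms by (subst (asm) sum_nonneg_eq_0_iff) (auto simp: a_le_1)
  then show "a u x = 1" by (simp add: a_sym)
qed

lemma sum_adjacent_x:
  assumes "u \<in> V" "u \<noteq> x" shows "(\<Sum>w\<in>P. a u w) + (\<Sum>w\<in>Q. a u w) = 6 * \<alpha> u"
proof -
  have "(\<Sum>w\<in>P. a u w * a w x) = (\<Sum>w\<in>P. a u w)" "(\<Sum>w\<in>Q. a u w * a w x) = (\<Sum>w\<in>Q. a u w)"
    by (auto intro!: sum.cong simp: x_adjacent)
  then show ?thesis
    using square[of u x] assms by (simp only: sum_V) (simp add: T_x \<alpha>_x)
qed

lemma sum_\<alpha>: "u \<in> V \<Longrightarrow> 6 * a u x + 5 * (\<Sum>w\<in>P. a u w) + 3 * (\<Sum>w\<in>T. a u w) + 2 * (\<Sum>w\<in>Q. a u w) = 30 * \<alpha> u"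
  using eigen[of u] by (simp only: sum_V) (simp add: \<alpha>_x \<alpha>_P \<alpha>_T \<alpha>_Q flip: sum_distrib_right)

text \<open>Common neighbours with \<open>x\<close>, the eigenvector equation and the valency give
  three linear equations for the three sums. The same system serves \<open>Q\<close> and
  \<open>T\<close>.\<close>

lemma row_sums_P:
  assumes "u \<in> P"
  shows "(\<Sum>w\<in>P. a u w) = 25" "(\<Sum>w\<in>T. a u w) = 3" "(\<Sum>w\<in>Q. a u w) = 5"
proof -
  have *: "u \<in> V" "u \<noteq> x" "\<alpha> u = 5" "a u x = 1"
    using assms disj by (auto simp: \<alpha>_P x_adjacent)
  show "(\<Sum>w\<in>P. a u w) = 25" "(\<Sum>w\<in>T. a u w) = 3" "(\<Sum>w\<in>Q. a u w) = 5"
    using sum_adjacent_x[OF *(1,2)] sum_\<alpha>[OF *(1)] degree[OF *(1)] unfolding sum_V *(3,4) by simp_all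
qed

lemma row_sums_Q:
  assumes "u \<in> Q"
  shows "(\<Sum>w\<in>P. a u w) = 10" "(\<Sum>w\<in>T. a u w) = 0" "(\<Sum>w\<in>Q. a u w) = 2"
proof -
  have *: "u \<in> V" "u \<noteq> x" "\<alpha> u = 2" "a u x = 1"
    using assms disj by (auto simp: \<alpha>_Q x_adjacent)
  show "(\<Sum>w\<in>P. a u w) = 10" "(\<Sum>w\<in>T. a u w) = 0" "(\<Sum>w\<in>Q. a u w) = 2"
    using sum_adjacent_x[OF *(1,2)] sum_\<alpha>[OF *(1)] degree[OF *(1)] unfolding sum_V *(3,4) by simp_all
qed

lemma row_sums_T:
  assumes "u \<in> T"
  shows "(\<Sum>w\<in>P. a u w) = 18" "(\<Sum>w\<in>T. a u w) = 0" "(\<Sum>w\<in>Q. a u w) = 0"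
proof -
  have *: "u \<in> V" "u \<noteq> x" "\<alpha> u = 3" "a u x = 0"
    using assms disj by (auto simp: \<alpha>_T T_x)
  show "(\<Sum>w\<in>P. a u w) = 18" "(\<Sum>w\<in>T. a u w) = 0" "(\<Sum>w\<in>Q. a u w) = 0"
    using sum_adjacent_x[OF *(1,2)] sum_\<alpha>[OF *(1)] degree[OF *(1)] unfolding sum_V *(3,4) by simp_all
qed

lemma T_independent:
  assumes "z \<in> T" and "w \<in> T \<union> Q" shows "a z w = 0" "a w z = 0"
proof -
  have "(\<Sum>w\<in>T\<union>Q. a z w) = 0"
    using row_sums_T[OF assms(1)] fin disj by (simp add: sum.union_disjoint)
  then show "a z w = 0" using fin assms by (subst (asm) sum_nonneg_eq_0_iff) (auto simp: a_nonneg)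
  then show "a w z = 0" by (simp add: a_sym)
qed

section \<open>Intersection numbers and the complement on \<open>P\<close>\<close>

definition t where "t u v = (\<Sum>z\<in>T. a u z * a v z)"
definition s where "s u v = (\<Sum>y\<in>Q. a u y * a v y)"
definition k where "k u y = (\<Sum>w\<in>Q. a u w * a w y)"
definition b where "b u v = (if u = v then 0 else 1 - a u v)"
definition c where "c u v = (\<Sum>w\<in>P. b u w * b w v)"
text \<open>This counts walks of length 3 from \<open>u\<close> to \<open>v\<close> with both inner
  vertices in \<open>Q\<close>.\<close>

definition \<kappa> where "\<kappa> u v = (\<Sum>y\<in>Q. a u y * k v y)"

lemma b_sym: "b u v = b v u" by (simp add: b_def a_sym)
lemma b_cases: "b u v = 0 \<or> b u v = 1" using a_cases[of u v] by (auto simp: b_def)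
lemma b_nonneg: "0 \<le> b u v" using b_cases[of u v] by auto
lemma t_sym: "t u v = t v u" by (simp add: t_def mult.commute)
lemma s_sym: "s u v = s v u" by (simp add: s_def mult.commute)

lemma \<kappa>_sym: "\<kappa> u v = \<kappa> v u"
  using sum_mult_swap[of "\<lambda>y. a u y" "\<lambda>w. a v w" "\<lambda>y w. a w y" Q Q]
  unfolding \<kappa>_def k_def by (simp add: a_sym)

text \<open>On \<open>P\<close>, \<open>b\<close> is the all-ones matrix minus the identity minus
  \<open>a\<close>.\<close>

lemma sum_b:
  assumes "u \<in> P"
  shows "(\<Sum>w\<in>P. b u w * f w) = (\<Sum>w\<in>P. f w) - f u - (\<Sum>w\<in>P. a u w * f w)"
proof -
  have "b u w * f w = f w - (if w = u then f w else 0) - a u w * f w" for w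
    by (auto simp: b_def algebra_simps)
  then show ?thesis using assms fin by (simp add: sum_subtractf)
qed

lemma sum_b_1: "u \<in> P \<Longrightarrow> (\<Sum>w\<in>P. b u w) = 4"
  using sum_b[of u "\<lambda>_. 1"] by (simp add: cards row_sums_P)

text \<open>Of the \<open>5 * 5\<close> common neighbours one is \<open>x\<close>, and those in
  \<open>T\<close> and \<open>Q\<close> are counted by \<open>t\<close> and \<open>s\<close>. The
  other pairs of classes are treated alike.\<close>

lemma common_PP:
  assumes "u \<in> P" "v \<in> P" "u \<noteq> v"
  shows "(\<Sum>w\<in>P. a u w * a w v) = 24 - t u v - s u v"
  using square[of u v] assms x_adjacent[of u] x_adjacent[of v]
  unfolding sum_V by (simp add: \<alpha>_P t_def s_def a_sym[of _ v])

lemma common_PT: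
  assumes "u \<in> P" "z \<in> T"
  shows "(\<Sum>w\<in>P. a u w * a w z) = 15"
proof -
  have "u \<noteq> z" using assms disj by auto
  then show ?thesis using square[of u z] assms T_x[of z] T_independent[of z]
    unfolding sum_V by (simp add: \<alpha>_P \<alpha>_T)
qed

lemma common_PQ:
  assumes "u \<in> P" "y \<in> Q"
  shows "(\<Sum>w\<in>P. a u w * a w y) = 9 - k u y"
proof -
  have "u \<noteq> y" using assms disj by auto
  then show ?thesis using square[of u y] assms x_adjacent[of u] x_adjacent[of y] T_independent[of _ y]
    unfolding sum_V by (simp add: \<alpha>_P \<alpha>_Q k_def)
qed

lemma common_QQ:
  assumes "y \<in> Q" "y' \<in> Q" "y \<noteq> y'"
  shows "(\<Sum>w\<in>P. a y w * a w y') = 3 - k y y'"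
  using square[of y y'] assms x_adjacent[of y] x_adjacent[of y'] T_independent[of _ y']
    unfolding sum_V by (simp add: \<alpha>_Q k_def)

text \<open>Expressing both factors of \<open>c\<close> through \<open>a\<close> reduces it to the
  common neighbours in \<open>P\<close>: \<open>c u v = 3 - (1 + t u v + s u v)\<close>.\<close>

lemma b_edge:
  assumes "u \<in> P" "v \<in> P" "b u v = 1"
  shows "t u v + s u v + c u v = 2"
proof -
  have uv: "u \<noteq> v" "a u v = 0" using assms by (auto simp: b_def split: if_splits)
  have "c u v = 3 - (\<Sum>w\<in>P. a u w * b w v)"
    unfolding c_def using sum_b[OF assms(1), of "\<lambda>w. b w v"] sum_b_1[OF assms(2)] assms(3)
    by (simp add: b_sym[of _ v])
  also have "(\<Sum>w\<in>P. a u w * b w v) = (\<Sum>w\<in>P. b v w * a w u)"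
    by (simp add: b_sym[of v] a_sym[of u] mult.commute)
  also have "\<dots> = 1 + t u v + s u v"
    using sum_b[OF assms(2), of "\<lambda>w. a w u"] row_sums_P[OF assms(1)] common_PP[of v u] assms uv
    by (simp add: a_sym[of _ u] t_sym s_sym)
  finally show ?thesis by simp
qed

lemma s_nonneg: "0 \<le> s u v" by (simp add: s_def sum_nonneg a_nonneg)
lemma c_nonneg: "0 \<le> c u v" by (simp add: c_def sum_nonneg b_nonneg)

text \<open>Two triples in a set of 5 points meet.\<close>

lemma t_ge_1: assumes "u \<in> P" "v \<in> P" shows "t u v \<ge> 1"
proof -
  have "0 \<le> (\<Sum>z\<in>T. (1 - a u z) * (1 - a v z))" by (intro sum_nonneg mult_nonneg_nonneg) (simp_all add: a_le_1)
  also have "\<dots> = t u v - 1"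
    using row_sums_P[OF assms(1)] row_sums_P[OF assms(2)]
    by (simp add: algebra_simps sum.distrib sum_subtractf t_def cards)
  finally show ?thesis by simp
qed

text \<open>Each point of \<open>T\<close> covered by \<open>n\<close> of three triples lies in \<open>n choose 2 \<ge> n - 1\<close> of
  the pairwise intersections.\<close>

lemma t_triple: assumes "u \<in> P" "v \<in> P" "w \<in> P" shows "t u v + t u w + t v w \<ge> 4"
proof -
  have "a u z + a v z + a w z - 1 \<le> a u z * a v z + a u z * a w z + a v z * a w z" for z
    using a_cases[of u z] a_cases[of v z] a_cases[of w z] by auto
  then have "(\<Sum>z\<in>T. a u z + a v z + a w z - 1) \<le> t u v + t u w + t v w"
    unfolding t_def sum.distrib[symmetric] by (rule sum_mono)
  then show ?thesis using row_sums_P assms by (simp add: sum.distrib sum_subtractf cards)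
qed

text \<open>In a triangle each edge has \<open>c \<ge> 1\<close>, hence \<open>t \<le> 1\<close>, so
  the three values of \<open>t\<close> sum to at most 3, against \<open>t_triple\<close>.\<close>

lemma b_triangle_free: assumes "u \<in> P" "v \<in> P" "b u v = 1" shows "c u v = 0"
proof (rule ccontr)
  assume "c u v \<noteq> 0"
  then obtain w where w: "w \<in> P" "b u w \<noteq> 0" "b w v \<noteq> 0"
    unfolding c_def by (metis (no_types, lifting) sum.neutral mult_eq_0_iff)
  then have w1: "b u w = 1" "b w v = 1" using b_cases by metis+
  have "c p q \<ge> 1" if "r \<in> P" "b p r = 1" "b r q = 1" for p q r
  proof -
    have "b p r * b r q \<le> c p q" unfolding c_def
      by (rule member_le_sum) (use that fin in \<open>auto simp: b_nonneg\<close>)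
    then show ?thesis using that by simp
  qed
  then have "c u v \<ge> 1" "c u w \<ge> 1" "c v w \<ge> 1"
    using assms w(1) w1 by (metis b_sym)+
  then have "t u v \<le> 1" "t u w \<le> 1" "t v w \<le> 1"
    using b_edge[of u v] b_edge[of u w] b_edge[of v w] assms w(1) w1
      s_nonneg[of u v] s_nonneg[of u w] s_nonneg[of v w] b_sym[of v w] by simp_all
  then show False using t_triple[OF assms(1,2) w(1)] by linarith
qed

lemma sum_b_a_T:
  assumes "u \<in> P" "z \<in> T" shows "(\<Sum>v\<in>P. b u v * a v z) = 3 - a u z"
  using sum_b[OF assms(1), of "\<lambda>v. a v z"] row_sums_T(1)[OF assms(2)] common_PT[OF assms]
  by (simp add: a_sym[of _ z])

lemma sum_b_a_Q:
  assumes "u \<in> P" "y \<in> Q" shows "(\<Sum>v\<in>P. b u v * a v y) = 1 - a u y + k u y"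
  using sum_b[OF assms(1), of "\<lambda>v. a v y"] row_sums_Q(1)[OF assms(2)] common_PQ[OF assms]
  by (simp add: a_sym[of _ y])

text \<open>Each of the three neighbours of \<open>u\<close> in \<open>T\<close> is adjacent to
  \<open>3 - 1\<close> of the \<open>b\<close>-neighbours of \<open>u\<close>.\<close>

lemma sum_b_t: assumes "u \<in> P" shows "(\<Sum>v\<in>P. b u v * t u v) = 6"
  using row_sums_P[OF assms] unfolding t_def
  by (subst sum_mult_swap)
    (simp add: sum_b_a_T assms right_diff_distrib sum_subtractf mult.commute[of _ 3] flip: sum_distrib_left)

lemma sum_b_s_\<kappa>: assumes "u \<in> P" shows "(\<Sum>v\<in>P. b u v * s u v) = \<kappa> u u"
  unfolding s_def \<kappa>_def
  by (subst sum_mult_swap) (simp add: sum_b_a_Q assms distrib_left right_diff_distrib sum_subtractf sum.distrib)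

text \<open>By triangle-freeness \<open>t + s = 2\<close> on each of the four \<open>b\<close>-edges
  at \<open>u\<close>; of the total 8, \<open>t\<close> takes 6.\<close>

lemma sum_b_s: assumes "u \<in> P" shows "(\<Sum>v\<in>P. b u v * s u v) = 2"
proof -
  have "b u v * (t u v + s u v) = b u v * 2" if "v \<in> P" for v
    using b_cases[of u v] b_edge[OF assms that] b_triangle_free[OF assms that] by auto
  then have "(\<Sum>v\<in>P. b u v * (t u v + s u v)) = (\<Sum>v\<in>P. b u v * 2)" by (rule sum.cong[OF refl])
  also have "\<dots> = 8" using sum_b_1[OF assms] by (simp flip: sum_distrib_right)
  finally show ?thesis using sum_b_t[OF assms] by (simp add: distrib_left sum.distrib)
qed

lemma \<kappa>_self: "u \<in> P \<Longrightarrow> \<kappa> u u = 2"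
  using sum_b_s sum_b_s_\<kappa> by simp

section \<open>The graph induced on \<open>Q\<close>\<close>

text \<open>Of the two neighbours of \<open>y\<close> in \<open>Q\<close>, one is \<open>w\<close>
  itself.\<close>

lemma k_le_1:
  assumes "y \<in> Q" "w \<in> Q" "a y w = 1" shows "k y w \<le> 1"
proof -
  have "k y w \<le> (\<Sum>v\<in>Q. a y v - (if v = w then a y v else 0))"
    unfolding k_def
  proof (rule sum_mono)
    fix v show "a y v * a v w \<le> a y v - (if v = w then a y v else 0)"
      using a_cases[of v w] a_nonneg[of y v] by auto
  qed
  also have "\<dots> = 1" using assms row_sums_Q[of y] fin by (simp add: sum_subtractf)
  finally show ?thesis .
qed

text \<open>Double counting of adjacent ordered pairs in \<open>Q\<close> with a common neighbour in
  \<open>P\<close>: the vertices of \<open>P\<close> give \<open>30 * 2\<close>, each pair gives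
  \<open>3 - k\<close>, and there are \<open>15 * 2\<close> pairs. As \<open>k \<le> 1\<close> on
  them, equality must hold everywhere.\<close>

lemma sum_a_k: "(\<Sum>y\<in>Q. \<Sum>w\<in>Q. a y w * (1 - k y w)) = 0"
proof -
  have "60 = (\<Sum>u\<in>P. \<kappa> u u)" by (simp add: \<kappa>_self cards)
  also have "\<dots> = (\<Sum>u\<in>P. \<Sum>y\<in>Q. \<Sum>w\<in>Q. a y w * (a y u * a u w))"
    by (simp add: \<kappa>_def k_def sum_distrib_left a_sym[of _ u for u] mult.commute mult.left_commute)
  also have "\<dots> = (\<Sum>y\<in>Q. \<Sum>u\<in>P. \<Sum>w\<in>Q. a y w * (a y u * a u w))" by (rule sum.swap)
  also have "\<dots> = (\<Sum>y\<in>Q. \<Sum>w\<in>Q. \<Sum>u\<in>P. a y w * (a y u * a u w))"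
    by (intro sum.cong refl sum.swap)
  also have "\<dots> = (\<Sum>y\<in>Q. \<Sum>w\<in>Q. a y w * (3 - k y w))"
  proof (intro sum.cong refl)
    fix y w assume "y \<in> Q" "w \<in> Q"
    then show "(\<Sum>u\<in>P. a y w * (a y u * a u w)) = a y w * (3 - k y w)"
      using common_QQ[of y w] by (cases "y = w") (simp_all flip: sum_distrib_left)
  qed
  also have "\<dots> = (\<Sum>y\<in>Q. \<Sum>w\<in>Q. a y w * (1 - k y w) + 2 * a y w)"
    by (simp add: algebra_simps)
  also have "\<dots> = (\<Sum>y\<in>Q. \<Sum>w\<in>Q. a y w * (1 - k y w)) + (\<Sum>y\<in>Q. 2 * (\<Sum>w\<in>Q. a y w))"
    by (simp add: sum.distrib sum_distrib_left)
  also have "(\<Sum>y\<in>Q. 2 * (\<Sum>w\<in>Q. a y w)) = 60" by (simp add: row_sums_Q cards)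
  finally show ?thesis by simp
qed

lemma k_adjacent:
  assumes "y \<in> Q" "w \<in> Q" "a y w = 1" shows "k y w = 1"
proof -
  have nonneg: "0 \<le> a p q * (1 - k p q)" if "p \<in> Q" "q \<in> Q" for p q
    using a_cases[of p q] k_le_1[OF that] by auto
  then have "(\<Sum>w\<in>Q. a y w * (1 - k y w)) = 0"
    using sum_a_k fin assms by (subst (asm) sum_nonneg_eq_0_iff) (auto intro: sum_nonneg)
  then have "a y w * (1 - k y w) = 0"
    using nonneg fin assms by (subst (asm) sum_nonneg_eq_0_iff) auto
  then show ?thesis using assms by simp
qed

text \<open>That is, \<open>Q\<close> induces a disjoint union of triangles.\<close>

lemma k_QQ:
  assumes "y \<in> Q" "w \<in> Q" shows "k y w = a y w + (if y = w then 2 else 0)"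
proof -
  define d where "d v = k y v - a y v - (if y = v then 2 else 0)" for v
  have kyy: "k y y = 2" using row_sums_Q(3)[OF assms(1)] by (simp add: k_def a_sym[of _ y])
  have "0 \<le> k y v" for v by (simp add: k_def sum_nonneg a_nonneg)
  then have "0 \<le> d v" if "v \<in> Q" for v
    using that a_cases[of y v] k_adjacent[OF assms(1) that] kyy by (auto simp: d_def)
  \<comment> \<open>From \<open>y\<close> there are \<open>2 * 2\<close> walks of length 2 in
    \<open>Q\<close>; two return to \<open>y\<close> and two end at its neighbours, so none is
    left.\<close>
  moreover have "(\<Sum>v\<in>Q. d v) = 0"
  proof -
    have "(\<Sum>v\<in>Q. k y v) = (\<Sum>v\<in>Q. 1 * k y v)" by simp
    also have "\<dots> = (\<Sum>z\<in>Q. a y z * (\<Sum>v\<in>Q. 1 * a z v))"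
      unfolding k_def by (rule sum_mult_swap)
    also have "\<dots> = 4" using row_sums_Q(3)[OF assms(1)] by (simp add: row_sums_Q flip: sum_distrib_right)
    finally show ?thesis using assms fin row_sums_Q(3)[of y] by (simp add: d_def sum_subtractf)
  qed
  ultimately have "d w = 0" using fin assms by (simp add: sum_nonneg_eq_0_iff)
  then show ?thesis by (simp add: d_def)
qed

lemma sum_k: assumes "u \<in> P" shows "(\<Sum>y\<in>Q. k u y) = 10"
proof -
  have "(\<Sum>y\<in>Q. k u y) = (\<Sum>y\<in>Q. 1 * k u y)" by simp
  also have "\<dots> = (\<Sum>z\<in>Q. a u z * (\<Sum>y\<in>Q. 1 * a z y))"
    unfolding k_def by (rule sum_mult_swap)
  finally show ?thesis using row_sums_P(3)[OF assms] by (simp add: row_sums_Q flip: sum_distrib_right)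
qed

text \<open>The triangles mean that the adjacency matrix of \<open>Q\<close> satisfies
  \<open>X^2 = X + 2\<close>; this is applied to the row of \<open>u\<close>.\<close>

lemma sum_k_a:
  assumes "w \<in> Q" shows "(\<Sum>y\<in>Q. k u y * a y w) = k u w + 2 * a u w"
proof -
  have "(\<Sum>y\<in>Q. k u y * a y w) = (\<Sum>y\<in>Q. a w y * (\<Sum>v\<in>Q. a u v * a v y))"
    by (simp add: k_def a_sym[of _ w] mult.commute)
  also have "\<dots> = (\<Sum>v\<in>Q. a u v * (\<Sum>y\<in>Q. a w y * a v y))" by (rule sum_mult_swap)
  also have "\<dots> = (\<Sum>v\<in>Q. a u v * k v w)" by (simp add: k_def a_sym[of w] mult.commute)
  also have "\<dots> = (\<Sum>v\<in>Q. a u v * a v w + (if v = w then 2 * a u v else 0))"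
    using assms by (intro sum.cong refl) (simp add: k_QQ distrib_left)
  finally show ?thesis using assms fin by (simp add: sum.distrib k_def)
qed

lemma sum_k_sq: assumes "u \<in> P" shows "(\<Sum>y\<in>Q. k u y * k u y) = 12"
proof -
  have "(\<Sum>y\<in>Q. k u y * k u y) = (\<Sum>y\<in>Q. k u y * (\<Sum>w\<in>Q. a u w * a w y))" by (simp add: k_def)
  also have "\<dots> = (\<Sum>w\<in>Q. a u w * (\<Sum>y\<in>Q. k u y * a w y))" by (rule sum_mult_swap)
  also have "\<dots> = (\<Sum>w\<in>Q. a u w * (k u w + 2 * a u w))"
    by (intro sum.cong refl, subst sum_k_a[symmetric]) (simp_all add: a_sym)
  also have "\<dots> = \<kappa> u u + 2 * (\<Sum>w\<in>Q. a u w)"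
    by (simp add: \<kappa>_def distrib_left sum.distrib sum_distrib_left mult.left_commute)
  finally show ?thesis using assms by (simp add: \<kappa>_self row_sums_P)
qed

text \<open>Summing over \<open>Q\<close> first leaves \<open>k - a k + k^2\<close>, with sums 10, 2
  and 12.\<close>

lemma sum_b_\<kappa>: assumes "u \<in> P" shows "(\<Sum>v\<in>P. b u v * \<kappa> u v) = 20"
proof -
  have "(\<Sum>v\<in>P. b u v * \<kappa> u v) = (\<Sum>v\<in>P. b u v * (\<Sum>y\<in>Q. k u y * a v y))"
    by (subst \<kappa>_sym) (simp add: \<kappa>_def mult.commute)
  also have "\<dots> = (\<Sum>y\<in>Q. k u y * (\<Sum>v\<in>P. b u v * a v y))" by (rule sum_mult_swap)
  also have "\<dots> = (\<Sum>y\<in>Q. k u y - a u y * k u y + k u y * k u y)"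
    using assms by (intro sum.cong refl) (simp add: sum_b_a_Q distrib_left right_diff_distrib)
  also have "\<dots> = 20"
    using sum_k sum_k_sq \<kappa>_self assms by (simp add: sum.distrib sum_subtractf \<kappa>_def)
  finally show ?thesis .
qed

section \<open>The semidefinite form and the contradiction\<close>

text \<open>On \<open>\<alpha>\<^sup>\<bottom>\<close> the adjacency matrix \<open>A\<close> satisfies \<open>A\<^sup>2 = 9\<close>, so \<open>(A + 3)\<^sup>2 = 6 (A + 3)\<close> there.\<close>

lemma quadratic_form_nonneg:
  assumes "(\<Sum>w\<in>V. \<alpha> w * f w) = 0"
  shows "0 \<le> (\<Sum>w\<in>V. f w * (3 * f w + (\<Sum>v\<in>V. a w v * f v)))"
proof -
  define h where "h w = (\<Sum>v\<in>V. a w v * f v)" for w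
  have fV: "finite V" using fin by simp
  have Ah: "(\<Sum>w\<in>V. a v w * h w) = 9 * f v" if "v \<in> V" for v
  proof -
    have "(\<Sum>w\<in>V. a v w * h w) = (\<Sum>w\<in>V. a v w * (\<Sum>u\<in>V. f u * a w u))"
      by (simp only: h_def mult.commute)
    also have "\<dots> = (\<Sum>u\<in>V. f u * (\<Sum>w\<in>V. a v w * a w u))" by (rule sum_mult_swap)
    also have "\<dots> = (\<Sum>u\<in>V. (if v = u then 9 * f u else 0) + \<alpha> v * (\<alpha> u * f u))"
      by (intro sum.cong refl, subst square[OF that]) (auto simp: algebra_simps)
    also have "\<dots> = 9 * f v"
      using that assms fV by (simp only: sum.distrib sum.delta' if_True flip: sum_distrib_left)
    finally show ?thesis .
  qed
  have "(\<Sum>w\<in>V. h w * h w) = (\<Sum>w\<in>V. h w * (\<Sum>v\<in>V. f v * a w v))"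
    by (simp only: h_def mult.commute)
  also have "\<dots> = (\<Sum>v\<in>V. f v * (\<Sum>w\<in>V. h w * a w v))" by (rule sum_mult_swap)
  also have "\<dots> = (\<Sum>v\<in>V. f v * (9 * f v))"
    by (intro sum.cong refl, subst Ah[symmetric]) (simp_all only: a_sym mult.commute)
  finally have hh: "(\<Sum>w\<in>V. h w * h w) = (\<Sum>v\<in>V. f v * (9 * f v))" .
  have "0 \<le> (\<Sum>w\<in>V. (3 * f w + h w) * (3 * f w + h w))" by (rule sum_nonneg) simp
  also have "\<dots> = (\<Sum>w\<in>V. h w * h w + (9 * (f w * f w) + 6 * (f w * h w)))"
    by (intro sum.cong refl) (simp add: algebra_simps)
  also have "\<dots> = (\<Sum>w\<in>V. f w * (9 * f w)) + (\<Sum>w\<in>V. 9 * (f w * f w) + 6 * (f w * h w))"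
    by (simp only: sum.distrib hh)
  also have "\<dots> = (\<Sum>w\<in>V. 6 * (f w * (3 * f w + h w)))"
    unfolding sum.distrib[symmetric] by (intro sum.cong refl) (simp add: algebra_simps)
  also have "\<dots> = 6 * (\<Sum>w\<in>V. f w * (3 * f w + h w))" by (simp only: sum_distrib_left)
  finally show ?thesis by (simp only: h_def zero_le_mult_iff) simp
qed

text \<open>\<open>\<phi> u\<close> is \<open>30\<close> times the unit vector of \<open>u\<close>, corrected outside \<open>P\<close> so that it is orthogonal to
  \<open>\<alpha>\<close> and that \<open>(A + 3) \<phi> u\<close> is supported on \<open>P\<close>, where it equals \<open>W u\<close>.\<close>

definition \<phi> where
  "\<phi> u w = (if w \<in> P then if w = u then 30 else 0 else if w \<in> T then - 10 * a u w
     else if w \<in> Q then 3 * k u w - 12 * a u w else 0)"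

lemma sum_\<phi>:
  assumes "u \<in> P"
  shows "(\<Sum>w\<in>V. g w * \<phi> u w) =
    30 * g u - 10 * (\<Sum>z\<in>T. g z * a u z) + 3 * (\<Sum>y\<in>Q. g y * k u y) - 12 * (\<Sum>y\<in>Q. g y * a u y)"
proof -
  have "(\<Sum>w\<in>P. g w * \<phi> u w) = (\<Sum>w\<in>P. if w = u then 30 * g w else 0)"
    by (intro sum.cong refl) (simp add: \<phi>_def)
  moreover have "(\<Sum>w\<in>T. g w * \<phi> u w) = (\<Sum>w\<in>T. - 10 * (g w * a u w))"
    using disj by (intro sum.cong refl) (auto simp: \<phi>_def)
  moreover have "(\<Sum>w\<in>Q. g w * \<phi> u w) = (\<Sum>w\<in>Q. 3 * (g w * k u w) - 12 * (g w * a u w))"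
    using disj by (intro sum.cong refl) (auto simp: \<phi>_def algebra_simps)
  moreover have "\<phi> u x = 0" using disj by (simp add: \<phi>_def)
  ultimately show ?thesis
    using assms fin unfolding sum_V sum_subtractf sum_distrib_left[symmetric] by simp
qed

lemma \<phi>_orthogonal: assumes "u \<in> P" shows "(\<Sum>w\<in>V. \<alpha> w * \<phi> u w) = 0"
  using row_sums_P[OF assms] sum_k[OF assms]
  by (subst sum_\<phi>[OF assms]) (simp add: \<alpha>_P \<alpha>_T \<alpha>_Q assms flip: sum_distrib_left)

definition W where
  "W u w = 90 * (if u = w then 1 else 0) + 30 * a u w - 10 * t u w + 3 * \<kappa> u w - 12 * s u w"

text \<open>The coefficients of \<open>\<phi>\<close> solve these cancellations:
  \<open>30 + 3 * 10 - 12 * 5\<close> at \<open>x\<close>, \<open>- 30 + 30\<close> at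
  \<open>T\<close>, and at \<open>Q\<close> \<open>9 + 3 - 12\<close> for \<open>k\<close> and
  \<open>- 36 + 30 + 6\<close> for \<open>a\<close>.\<close>

lemma \<phi>_image:
  assumes "u \<in> P" "w \<in> V"
  shows "3 * \<phi> u w + (\<Sum>v\<in>V. a w v * \<phi> u v) = (if w \<in> P then W u w else 0)"
proof -
  consider "w = x" | "w \<in> P" | "w \<in> T" | "w \<in> Q" using assms by auto
  then show ?thesis
  proof cases
    case 1
    have "(\<Sum>y\<in>Q. a x y * k u y) = (\<Sum>y\<in>Q. k u y)" "(\<Sum>y\<in>Q. a x y * a u y) = (\<Sum>y\<in>Q. a u y)"
      by (auto intro!: sum.cong simp: x_adjacent)
    then show ?thesis using 1 assms disj row_sums_P[OF assms(1)] sum_k[OF assms(1)]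
      by (subst sum_\<phi>) (auto simp: \<phi>_def T_x x_adjacent)
  next
    case 2
    have "t u w = (\<Sum>z\<in>T. a w z * a u z)" "s u w = (\<Sum>y\<in>Q. a w y * a u y)"
      "\<kappa> u w = (\<Sum>y\<in>Q. a w y * k u y)"
      by (simp_all add: t_def s_def mult.commute) (subst \<kappa>_sym, simp add: \<kappa>_def mult.commute)
    then show ?thesis using assms 2
      by (subst sum_\<phi>) (auto simp: \<phi>_def W_def a_sym[of u w])
  next
    case 3
    then have "w \<notin> P" using disj by auto
    then show ?thesis using assms 3
      by (subst sum_\<phi>) (auto simp: \<phi>_def T_independent a_sym[of u w])
  next
    case 4
    then have "w \<notin> P" "w \<notin> T" using disj by auto
    moreover have "(\<Sum>y\<in>Q. a w y * k u y) = k u w + 2 * a u w"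
      using sum_k_a[OF 4, of u] by (simp add: a_sym[of _ w] mult.commute)
    moreover have "(\<Sum>y\<in>Q. a w y * a u y) = k u w"
      by (simp add: k_def a_sym[of _ w] mult.commute)
    ultimately show ?thesis using assms 4
      by (subst sum_\<phi>) (auto simp: \<phi>_def T_independent a_sym[of u w])
  qed
qed

lemma W_self: "u \<in> P \<Longrightarrow> W u u = 6"
  using row_sums_P[of u] by (simp add: W_def t_def s_def \<kappa>_self)

text \<open>The form is evaluated at \<open>\<phi> u + \<phi> v\<close>. Only \<open>u\<close> and
  \<open>v\<close> contribute, and the value is \<open>30 * (6 + 2 * W u v + 6)\<close>.\<close>

lemma W_ge: assumes "u \<in> P" "v \<in> P" "u \<noteq> v" shows "- 6 \<le> W u v"
proof -
  define f where "f w = \<phi> u w + \<phi> v w" for w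
  have "(\<Sum>w\<in>V. \<alpha> w * f w) = 0"
    using \<phi>_orthogonal[OF assms(1)] \<phi>_orthogonal[OF assms(2)] by (simp only: f_def distrib_left sum.distrib)
  then have "0 \<le> (\<Sum>w\<in>V. f w * (3 * f w + (\<Sum>v\<in>V. a w v * f v)))" by (rule quadratic_form_nonneg)
  also have "\<dots> = (\<Sum>w\<in>V. f w * (if w \<in> P then W u w + W v w else 0))"
  proof (rule sum.cong[OF refl])
    fix w assume w: "w \<in> V"
    have "3 * f w + (\<Sum>v\<in>V. a w v * f v) = (3 * \<phi> u w + (\<Sum>v\<in>V. a w v * \<phi> u v)) + (3 * \<phi> v w + (\<Sum>r\<in>V. a w r * \<phi> v r))"
      by (simp only: f_def distrib_left sum.distrib)
    then show "f w * (3 * f w + (\<Sum>v\<in>V. a w v * f v)) = f w * (if w \<in> P then W u w + W v w else 0)"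
      by (simp only: \<phi>_image[OF assms(1) w] \<phi>_image[OF assms(2) w]) simp
  qed
  also have "\<dots> = (\<Sum>w\<in>P. f w * (W u w + W v w))"
  proof -
    have "w \<notin> P" if "w \<in> T \<union> Q" for w using that disj by auto
    then show ?thesis using disj unfolding sum_V by simp
  qed
  also have "\<dots> = (\<Sum>w\<in>P. (if w = u then 30 * (W u w + W v w) else 0) + (if w = v then 30 * (W u w + W v w) else 0))"
    by (intro sum.cong refl) (auto simp: f_def \<phi>_def distrib_right)
  also have "\<dots> = 30 * (W u u + W v u) + 30 * (W u v + W v v)"
    using assms fin by (simp add: sum.distrib)
  also have "W v u = W u v"
    by (simp add: W_def a_sym[of v] t_sym[of v] s_sym[of v] \<kappa>_sym[of v] eq_commute)
  finally show ?thesis using W_self assms by simp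
qed

lemma contradiction: False
proof -
  obtain u where u: "u \<in> P" using cards by fastforce
  have eq: "b u v * W u v = - 10 * (b u v * t u v) + 3 * (b u v * \<kappa> u v) - 12 * (b u v * s u v)" for v
    using a_cases[of u v] by (auto simp: W_def b_def)
  \<comment> \<open>The total is \<open>- 10 * 6 + 3 * 20 - 12 * 2 + 6 * 4\<close>.\<close>
  have "(\<Sum>v\<in>P. b u v * (W u v + 6)) = 0"
    unfolding distrib_left sum.distrib eq sum_subtractf sum_distrib_left[symmetric] sum_distrib_right[symmetric]
    by (simp add: sum_b_t[OF u] sum_b_\<kappa>[OF u] sum_b_s[OF u] sum_b_1[OF u])
  moreover have "0 \<le> b u v * (W u v + 6)" if "v \<in> P" for v
    using W_ge[OF u that] b_cases[of u v] by (auto simp: b_def)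
  ultimately have tight: "b u v * (W u v + 6) = 0" if "v \<in> P" for v
    using fin that by (simp add: sum_nonneg_eq_0_iff)
  obtain v where v: "v \<in> P" "b u v = 1"
    using sum_b_1[OF u] b_cases[of u] by (metis sum.neutral zero_neq_numeral)
  then have "b u v * W u v = - 6" using tight by fastforce
  then have "10 * t u v = 3 * (2 + \<kappa> u v - 4 * s u v)" using v unfolding eq by simp
  \<comment> \<open>In the tight equation every coefficient except that of \<open>t\<close> is a
    multiple of 3.\<close>
  then have "3 dvd 10 * t u v" by simp
  moreover have "t u v = 1 \<or> t u v = 2"
    using t_ge_1[OF u v(1)] b_edge[OF u v] s_nonneg[of u v] c_nonneg[of u v] by linarith
  ultimately show False by auto
qed

end

section \<open>From the spectrum to the local structure\<close>

lemma card_indices: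
  assumes "distinct vs"
  shows "card {i. i < length vs \<and> R (vs ! i)} = card {v \<in> set vs. R v}"
proof -
  have "{v \<in> set vs. R v} = (\<lambda>i. vs ! i) ` {i. i < length vs \<and> R (vs ! i)}"
    by (auto simp: in_set_conv_nth)
  then show ?thesis using assms by (simp add: card_image inj_on_def nth_eq_iff_index_eq)
qed

lemma sum_arcs_eq_valency:
  assumes "pair_graph G" and vs: "distinct vs" "set vs = pverts G" and "i < length vs"
  shows "(\<Sum>j<length vs. of_bool ((vs ! i, vs ! j) \<in> parcs G)) = int (valency G (vs ! i))"
proof -
  interpret pair_graph G by fact
  have "out_arcs (with_proj G) (vs ! i) = Pair (vs ! i) ` {v \<in> set vs. (vs ! i, v) \<in> parcs G}"
    using vs by (auto simp: out_arcs_def dest: in_arcsD2)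
  then have "valency G (vs ! i) = card {v \<in> set vs. (vs ! i, v) \<in> parcs G}"
    by (simp add: valency_def out_degree_def card_image inj_on_def)
  also have "\<dots> = card {j. j < length vs \<and> (vs ! i, vs ! j) \<in> parcs G}"
    by (rule card_indices[OF vs(1), of "\<lambda>v. (vs ! i, v) \<in> parcs G", symmetric])
  finally show ?thesis by (simp add: Collect_conj_eq lessThan_def)
qed

text \<open>The orders exhaust the degree, so \<open>(A - 30) (A - 3) (A + 3) = 0\<close>; this is
  read off at entry \<open>(i, j)\<close> and transferred from the reals to the integers.\<close>

lemma adjacency_annihilated:
  fixes G :: "'a pair_pre_digraph" and vs
  defines "n \<equiv> length vs" and "a \<equiv> \<lambda>i j. of_bool ((vs ! i, vs ! j) \<in> parcs G)"
  defines "y \<equiv> \<lambda>i j. (\<Sum>k<n. a i k * a k j) - (if i = j then 9 else 0 :: int)"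
  assumes sym: "\<And>i j. a i j = a j i"
    and orders: "(\<Sum>r\<in>{30, 3, - 3}. Polynomial.order r (char_poly (adjacency_matrix G vs))) = n"
    and "i < n" "j < n"
  shows "(\<Sum>k<n. a i k * y k j) = 30 * y i j"
proof -
  let ?A = "adjacency_matrix G vs" and ?V = "{..<n}"
  have A: "?A \<in> carrier_mat n n" by (simp add: adjacency_matrix_def n_def)
  have Aa: "?A $$ (i, j) = of_int (a i j)" if "i < n" "j < n" for i j
    using that by (simp add: adjacency_matrix_def n_def a_def)
  note deg = degree_monic_char_poly[OF A]
  obtain es where es: "char_poly ?A = (\<Prod>e\<leftarrow>es. [:- e, 1:])" "set es \<subseteq> {30, 3, - 3}"
    by (rule splits_if_orders_sum_to_degree[of "{30, 3, - 3}" "char_poly ?A"]) (use deg orders in auto)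
  \<comment> \<open>The \<open>j\<close>-th unit vector: the shifts by \<open>- 3\<close> and
    \<open>3\<close> turn it into column \<open>j\<close> of \<open>A^2 - 9\<close>.\<close>
  define f :: "nat \<Rightarrow> real" where "f k = (if k = j then 1 else 0)" for k
  let ?S = "shift (\<lambda>i j. ?A $$ (i, j)) ?V"
  have "?S (- 3) f k = of_int (a k j) + 3 * f k" if "k < n" for k
    using that \<open>j < n\<close> by (simp add: shift_def f_def Aa if_distrib cong: if_cong)
  then have "?S 3 (?S (- 3) f) k = (\<Sum>l<n. of_int (a k l) * (of_int (a l j) + 3 * f l)) - 3 * (of_int (a k j) + 3 * f k)"
    if "k < n" for k
    using that by (simp add: shift_def[of _ _ 3] Aa)
  also have "\<dots> k = of_int (y k j)" if "k < n" for k
  proof -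
    have "(\<Sum>l<n. real_of_int (a k l) * (3 * f l)) = 3 * of_int (a k j)"
      using \<open>j < n\<close> by (simp add: f_def if_distrib cong: if_cong)
    then show ?thesis by (simp add: y_def f_def distrib_left sum.distrib)
  qed
  finally have "?S 30 (?S 3 (?S (- 3) f)) i = (\<Sum>k<n. of_int (a i k) * of_int (y k j)) - 30 * of_int (y i j)"
    using \<open>i < n\<close> by (simp add: shift_def[of _ _ 30] Aa)
  moreover have "?S 30 (?S 3 (?S (- 3) f)) i = 0"
    using symmetric_annihilated[OF A _ es(1), of "[30, 3, - 3]" i f] es(2) Aa sym \<open>i < n\<close> by simp
  ultimately have "real_of_int (\<Sum>k<n. a i k * y k j) = real_of_int (30 * y i j)" by simp
  then show ?thesis by (simp only: of_int_eq_iff)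
qed

theorem theorem8p5:
  shows "\<not> (\<exists>G :: 'a pair_pre_digraph.
           pair_graph G \<and>
           has_valency_array G [1, 30, 5, 15] [45, 34, 18, 13] \<and>
           has_spectrum G [(30, 1), (3, 20), (-3, 30)])"
proof
  assume "\<exists>G :: 'a pair_pre_digraph. pair_graph G \<and>
    has_valency_array G [1, 30, 5, 15] [45, 34, 18, 13] \<and>
    has_spectrum G [(30, 1), (3, 20), (-3, 30)]"
  then obtain G :: "'a pair_pre_digraph" where G: "pair_graph G"
    and val: "has_valency_array G [1, 30, 5, 15] [45, 34, 18, 13]"
    and spectrum: "has_spectrum G [(30, 1), (3, 20), (-3, 30)]" by blast
  interpret pair_graph G by (fact G)
  obtain vs where vs: "distinct vs" "set vs = pverts G"
    and orders: "\<forall>(\<theta>, m) \<in> set [(30, 1), (3, 20), (-3, 30)].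
      Polynomial.order \<theta> (char_poly (adjacency_matrix G vs)) = m"
    using spectrum unfolding has_spectrum_def by blast
  \<comment> \<open>Vertices are replaced by their positions in \<open>vs\<close>, so that the
    valency classes partition the index set of the matrix.\<close>
  define C where "C d = {i. i < length vs \<and> valency G (vs ! i) = d}" for d
  have class_size: "card {v \<in> pverts G. valency G v = [45, 34, 18, 13] ! i} = [1, 30, 5, 15] ! i"
    if "i < 4" for i
    using val that by (simp add: has_valency_array_def)
  have cards: "card (C 45) = 1" "card (C 34) = 30" "card (C 18) = 5" "card (C 13) = 15"
    unfolding C_def card_indices[OF vs(1), of "\<lambda>v. valency G v = _"] vs(2)
    using class_size[of 0] class_size[of 1] class_size[of 2] class_size[of 3] by simp_all
  have fin: "finite (C d)" for d by (simp add: C_def)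
  have disj: "C d \<inter> C e = {}" if "d \<noteq> e" for d e using that by (auto simp: C_def)
  obtain x where x: "C 45 = {x}" using cards(1) card_1_singletonE by blast
  have "valency G (vs ! i) \<in> {45, 34, 18, 13}" if "i < length vs" for i
    using val vs(2) that unfolding has_valency_array_def by auto
  then have V: "{..<length vs} = insert x (C 34 \<union> C 18 \<union> C 13)"
    using x by (auto simp: C_def)
  have xC: "x \<notin> C d" if "d \<noteq> 45" for d using disj[OF that] x by auto
  have n: "length vs = 51"
  proof -
    have "length vs = card {..<length vs}" by simp
    also have "\<dots> = 51" unfolding V
      using cards fin disj xC by (simp add: card_Un_disjoint Int_Un_distrib2)
    finally show ?thesis .
  qed
  define a :: "nat \<Rightarrow> nat \<Rightarrow> int" where "a i j = of_bool ((vs ! i, vs ! j) \<in> parcs G)" for i j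
  define \<alpha> :: "nat \<Rightarrow> int" where
    "\<alpha> i = (if i = x then 6 else if i \<in> C 34 then 5 else if i \<in> C 18 then 3 else 2)" for i
  have \<alpha>: "\<alpha> x = 6" "\<And>i. i \<in> C 34 \<Longrightarrow> \<alpha> i = 5" "\<And>i. i \<in> C 18 \<Longrightarrow> \<alpha> i = 3" "\<And>i. i \<in> C 13 \<Longrightarrow> \<alpha> i = 2"
    using xC disj[of 34 18] disj[of 34 13] disj[of 18 13] by (auto simp: \<alpha>_def)
  have a_sym: "a i j = a j i" for i j
    using pair_sym_arcs by (auto simp: a_def symmetric_def sym_def)
  have a_irrefl: "a i i = 0" for i using no_loops' by (auto simp: a_def)
  let ?y = "\<lambda>u v. (\<Sum>w<length vs. a u w * a w v) - (if u = v then 9 else 0)"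
  have diag: "?y i i = \<alpha> i * \<alpha> i" if "i \<in> {..<length vs}" for i
  proof -
    have "(\<Sum>w<length vs. a i w * a w i) = (\<Sum>w<length vs. a i w)"
      by (intro sum.cong refl) (simp add: a_sym[of _ i], simp add: a_def)
    also have "\<dots> = int (valency G (vs ! i))"
      unfolding a_def using that by (intro sum_arcs_eq_valency G vs) simp
    finally have "?y i i = int (valency G (vs ! i)) - 9" by simp
    moreover have "i \<in> insert x (C 34 \<union> C 18 \<union> C 13)" using that by (simp only: V)
    then consider "i = x" | "i \<in> C 34" | "i \<in> C 18" | "i \<in> C 13" by blast
    then have "int (valency G (vs ! i)) - 9 = \<alpha> i * \<alpha> i"
    proof cases
      case 1
      then have "i \<in> C 45" using x by simp
      then show ?thesis using 1 \<alpha>(1) by (simp add: C_def)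
    qed (use \<alpha> in \<open>simp_all add: C_def\<close>)
    ultimately show ?thesis by simp
  qed
  have trace: "(\<Sum>i<length vs. \<alpha> i * \<alpha> i) = 30 * 30 - 9"
  proof -
    have "sum (\<lambda>i. \<alpha> i * \<alpha> i) (C 34 \<union> C 18 \<union> C 13) = 30 * 25 + 5 * 9 + 15 * 4"
      using fin disj by (simp add: sum.union_disjoint Int_Un_distrib2 \<alpha> cards)
    then show ?thesis unfolding V using fin xC by (simp add: \<alpha>)
  qed
  \<comment> \<open>The multiplicities \<open>1 + 20 + 30\<close> add up to the number 51 of
    vertices.\<close>
  have eigen: "(\<Sum>w<length vs. a u w * ?y w v) = 30 * ?y u v"
    if "u \<in> {..<length vs}" "v \<in> {..<length vs}" for u v
    using adjacency_annihilated[of vs G u v] that a_sym orders n unfolding a_def by simp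
  have "0 \<le> a u v" "0 < \<alpha> u" for u v by (simp_all add: a_def \<alpha>_def)
  note square = rank_one_square[of "{..<length vs}" a 9 30 \<alpha>,
    OF finite_lessThan a_sym this(1) eigen diag this(2) trace, unfolded V]
  interpret three_eigenvalue_graph x "C 34" "C 18" "C 13" a \<alpha>
  proof
    show "a u v = 0 \<or> a u v = 1" for u v by (simp add: a_def)
  qed (rule square \<alpha> a_sym; assumption | simp add: fin cards xC disj a_irrefl)+
  show False by (rule contradiction)
qed

end
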